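(* Let $A=A_0\oplus A_1$ be a generic Poisson superalgebra (not necessarily unital) over a field $F$ of characteristic $\ne 2,3$. Then Kantor's double $K(A)$ is a Jordan superalgebra if and only if $A$ satisfies the identity $$\bigl(\{\{a,b\},c\}-(-1)^{|b||c|}\{\{a,c\},b\}-\{a,\{b,c\}\}\bigr)\cdot d=0$$ for all homogeneous elements $a,b,c,d\in A_0\cup A_1$.
   Context: A generic Poisson superalgebra (GP superalgebra) is a $\mathbb{Z}_2$-graded vector space $A=A_0\oplus A_1$ with an (even) associative supercommutative multiplication $\cdot$ and an (even) superanticommutative multiplication $\{,\}$, i.e. $\{x,y\}=-(-1)^{|x||y|}\{y,x\}$, satisfying the Leibniz identity $\{x,y\cdot z\}=\{x,y\}\cdot z+(-1)^{|x||y|}y\cdot\{x,z\}$ for homogeneous $x,y,z$. Kantor's double $K(A)$ is the superalgebra $K(A)=A\oplus Ax$, where $Ax$ is an isomorphic copy of the vector space $A$, with multiplication $*$ given for homogeneous $a,b\in A$ by $$a*b=ab,\quad a*bx=(ab)x,\quad ax*b=(-1)^{|b|}(ab)x,\quad ax*bx=(-1)^{|b|}\{a,b\},$$ and grading $K(A)_0=A_0\oplus A_1x$, $K(A)_1=A_1\oplus A_0x$. *)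

theory Defs
  imports "HOL-Analysis.Product_Vector" "HOL-Library.Z2"
begin

text \<open>
  Parities are elements of the field \<^typ>\<open>bit\<close> of two elements, so that sums and products of
  parities are computed modulo 2. A graded component is a subset \<open>A p\<close> of the underlying
  vector space; zero belongs to both components. An identity ``for homogeneous elements''
  is stated for all parities \<open>p\<close> and all elements of \<open>A p\<close>.
\<close>

text \<open>\<open>signed p x\<close> is \<open>(-1)\<^sup>p x\<close>.\<close>

definition signed :: "bit \<Rightarrow> 'a::ab_group_add \<Rightarrow> 'a" where
  "signed p x = (if p = 0 then x else - x)"

locale super_vector_space = vector_space scl
  for scl :: "'f::field \<Rightarrow> 'a::ab_group_add \<Rightarrow> 'a" +
  fixes A :: "bit \<Rightarrow> 'a set"
  assumes subspace_component: "subspace (A p)"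
    and components_disjoint: "A 0 \<inter> A 1 = {0}"
    and components_span: "\<exists>y\<in>A 0. \<exists>z\<in>A 1. x = y + z"

locale superalgebra = super_vector_space scl A
  for scl :: "'f::field \<Rightarrow> 'a::ab_group_add \<Rightarrow> 'a" and A :: "bit \<Rightarrow> 'a set" +
  fixes mult :: "'a \<Rightarrow> 'a \<Rightarrow> 'a"
  assumes mult_linear_right: "Vector_Spaces.linear scl scl (\<lambda>y. mult x y)"
    and mult_linear_left: "Vector_Spaces.linear scl scl (\<lambda>x. mult x y)"
    and mult_graded: "x \<in> A p \<Longrightarrow> y \<in> A q \<Longrightarrow> mult x y \<in> A (p + q)"

text \<open>
  The second axiom is the full linearization of \<open>(x\<^sup>2 z) x = x\<^sup>2 (z x)\<close> (with \<open>x, y, t\<close> the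
  linearized variables), each term carrying the sign of the permutation that it induces on the
  odd elements among \<open>x, y, z, t\<close>. In characteristic different from 2 and 3 this is
  the usual definition.
\<close>

locale jordan_superalgebra = superalgebra scl A mult
  for scl :: "'f::field \<Rightarrow> 'a::ab_group_add \<Rightarrow> 'a" and A :: "bit \<Rightarrow> 'a set"
    and mult :: "'a \<Rightarrow> 'a \<Rightarrow> 'a" +
  assumes supercommute:
    "x \<in> A p \<Longrightarrow> y \<in> A q \<Longrightarrow> mult x y = signed (p * q) (mult y x)"
    and jordan_identity:
    "x \<in> A p \<Longrightarrow> y \<in> A q \<Longrightarrow> z \<in> A r \<Longrightarrow> t \<in> A s \<Longrightarrow>
       mult (mult x y) (mult z t)
       + signed (q * r) (mult (mult x z) (mult y t))
       + signed (s * (q + r)) (mult (mult x t) (mult y z))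
       = mult (mult (mult x y) z) t
       + signed (s * (q + r) + q * r) (mult (mult (mult x t) z) y)
       + signed (p * (q + r + s) + r * s) (mult (mult (mult y t) z) x)"

locale gp_superalgebra =
  superalgebra scl A mult + bracket: superalgebra scl A br
  for scl :: "'f::field \<Rightarrow> 'a::ab_group_add \<Rightarrow> 'a" and A :: "bit \<Rightarrow> 'a set"
    and mult :: "'a \<Rightarrow> 'a \<Rightarrow> 'a" and br :: "'a \<Rightarrow> 'a \<Rightarrow> 'a" +
  assumes mult_assoc: "mult (mult x y) z = mult x (mult y z)"
    and mult_supercommute:
      "x \<in> A p \<Longrightarrow> y \<in> A q \<Longrightarrow> mult x y = signed (p * q) (mult y x)"
    and bracket_superanticommute:
      "x \<in> A p \<Longrightarrow> y \<in> A q \<Longrightarrow> br x y = - signed (p * q) (br y x)"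
    and leibniz:
      "x \<in> A p \<Longrightarrow> y \<in> A q \<Longrightarrow> z \<in> A r \<Longrightarrow>
         br x (mult y z) = mult (br x y) z + signed (p * q) (mult y (br x z))"

text \<open>
  The homogeneous component of parity \<open>p\<close>, and the grading automorphism
  \<open>x \<mapsto> (-1)\<^bsup>|x|\<^esup> x\<close>, extended additively to all elements.
\<close>

definition hpart :: "(bit \<Rightarrow> 'a::ab_group_add set) \<Rightarrow> bit \<Rightarrow> 'a \<Rightarrow> 'a" where
  "hpart A p x = (THE y. y \<in> A p \<and> x - y \<in> A (p + 1))"

definition grade_aut :: "(bit \<Rightarrow> 'a::ab_group_add set) \<Rightarrow> 'a \<Rightarrow> 'a" where
  "grade_aut A x = hpart A 0 x - hpart A 1 x"

text \<open>
  In Kantor's double, the pair \<open>(a, b)\<close> represents \<open>a + bx\<close>. The product is the bilinear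
  extension of the one defined on homogeneous elements; the defining formulas are recovered
  in the lemma \<open>kantor_mult_homogeneous\<close> below.
\<close>

definition kantor_grading :: "(bit \<Rightarrow> 'a set) \<Rightarrow> bit \<Rightarrow> ('a \<times> 'a) set" where
  "kantor_grading A p = A p \<times> A (p + 1)"

definition kantor_mult ::
  "(bit \<Rightarrow> 'a::ab_group_add set) \<Rightarrow> ('a \<Rightarrow> 'a \<Rightarrow> 'a) \<Rightarrow> ('a \<Rightarrow> 'a \<Rightarrow> 'a)
     \<Rightarrow> 'a \<times> 'a \<Rightarrow> 'a \<times> 'a \<Rightarrow> 'a \<times> 'a" where
  "kantor_mult A mult br = (\<lambda>(a, b) (c, d).
     (mult a c + br b (grade_aut A d), mult a d + mult b (grade_aut A c)))"

context super_vector_space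
begin

lemma hpart_eqI:
  assumes "y \<in> A p" "x - y \<in> A (p + 1)"
  shows "hpart A p x = y"
  unfolding hpart_def
proof (rule the_equality)
  fix w assume w: "w \<in> A p \<and> x - w \<in> A (p + 1)"
  have "w - y \<in> A p"
    using w assms subspace_component subspace_diff by blast
  moreover have "(x - y) - (x - w) \<in> A (p + 1)"
    using w assms subspace_component subspace_diff by blast
  then have "w - y \<in> A (p + 1)" by simp
  ultimately have "w - y \<in> A 0 \<inter> A 1"
    by (cases p) auto
  then show "w = y" using components_disjoint by simp
qed (use assms in simp)

lemma grade_aut_homogeneous:
  assumes "x \<in> A p"
  shows "grade_aut A x = signed p x"
proof -
  have z: "0 \<in> A q" for q
    using subspace_component subspace_0 by blast
  have "hpart A p x = x" "hpart A (p + 1) x = 0"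
    using assms z by (auto intro!: hpart_eqI simp: add.assoc)
  then show ?thesis
    by (cases p) (auto simp: grade_aut_def signed_def)
qed

end

lemma (in gp_superalgebra) kantor_mult_homogeneous:
  assumes "b \<in> A q"
  shows "kantor_mult A mult br (a, 0) (b, 0) = (mult a b, 0)"
    and "kantor_mult A mult br (a, 0) (0, b) = (0, mult a b)"
    and "kantor_mult A mult br (0, a) (b, 0) = (0, signed q (mult a b))"
    and "kantor_mult A mult br (0, a) (0, b) = (signed q (br a b), 0)"
proof -
  have z: "grade_aut A 0 = 0"
    using grade_aut_homogeneous[of 0 0] subspace_component subspace_0
    by (auto simp: signed_def)
  note hom = Vector_Spaces.linear.axioms(3)
  have lin: "mult x 0 = 0" "mult 0 x = 0" "br x 0 = 0" "br 0 x = 0"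
      "mult x (- y) = - mult x y" "br x (- y) = - br x y" for x y
    using module_hom.zero[OF hom[OF mult_linear_right]]
      module_hom.zero[OF hom[OF mult_linear_left]]
      module_hom.zero[OF hom[OF bracket.mult_linear_right]]
      module_hom.zero[OF hom[OF bracket.mult_linear_left]]
      module_hom.neg[OF hom[OF mult_linear_right]]
      module_hom.neg[OF hom[OF bracket.mult_linear_right]]
    by blast+
  show "kantor_mult A mult br (a, 0) (b, 0) = (mult a b, 0)"
    and "kantor_mult A mult br (a, 0) (0, b) = (0, mult a b)"
    and "kantor_mult A mult br (0, a) (b, 0) = (0, signed q (mult a b))"
    and "kantor_mult A mult br (0, a) (0, b) = (signed q (br a b), 0)"
    using grade_aut_homogeneous[OF assms]
    by (auto simp: kantor_mult_def z lin signed_def)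
qed

end

(*
  By additivity the Jordan identity of K(A) need only be checked on homogeneous elements lying in
  A or in Ax. If at least one of the four arguments lies in A, both sides agree by associativity,
  supercommutativity and the Leibniz identity. On ax, bx, cx, dx the Leibniz identity splits each
  {{a,b}c,d} into {{a,b},d}c and {a,b}{c,d}; the products of two brackets cancel, and what remains
  is, up to sign, the Jacobian of a, b, d multiplied by c.
*)

theory Submission
  imports Defs
begin

section \<open>Arithmetic of signs\<close>

lemma signed_zero: "signed p 0 = 0"
  and signed_add: "signed p (x + y) = signed p x + signed p y"
  and signed_diff: "signed p (x - y) = signed p x - signed p y"
  and signed_minus: "signed p (- x) = - signed p x"
  and signed_signed: "signed p (signed q x) = signed (p + q) x"
  by (cases p; cases q; simp add: signed_def)+

lemma signed_cancel: "signed p x = 0 \<longleftrightarrow> x = 0"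
  by (simp add: signed_def)

lemma signed_Pair: "signed p (x, y) = (signed p x, signed p y)"
  by (simp add: signed_def)

section \<open>Homogeneous components and the grading automorphism\<close>

context super_vector_space
begin

lemma component_zero: "0 \<in> A p"
  and component_add: "x \<in> A p \<Longrightarrow> y \<in> A p \<Longrightarrow> x + y \<in> A p"
  and component_scale: "x \<in> A p \<Longrightarrow> scl k x \<in> A p"
  and component_minus: "x \<in> A p \<Longrightarrow> - x \<in> A p"
  using subspace_component subspace_0 subspace_add subspace_scale subspace_neg by blast+

lemma component_signed: "x \<in> A p \<Longrightarrow> signed q x \<in> A p"
  by (simp add: signed_def component_minus)

lemma components_decompose:
  obtains y z where "y \<in> A 0" "z \<in> A 1" "x = y + z"
  using components_span by blast

text \<open>Allows linearity of \<open>grade_aut\<close> to be read off from any decomposition,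
  bypassing the definite description in \<open>hpart\<close>.\<close>

lemma grade_aut_sum:
  assumes "y \<in> A 0" "z \<in> A 1"
  shows "grade_aut A (y + z) = y - z"
proof -
  have "hpart A 0 (y + z) = y" "hpart A 1 (y + z) = z"
    using assms by (auto intro!: hpart_eqI)
  then show ?thesis by (simp add: grade_aut_def)
qed

lemma grade_aut_add: "grade_aut A (x + y) = grade_aut A x + grade_aut A y"
proof -
  obtain x0 x1 where x: "x0 \<in> A 0" "x1 \<in> A 1" "x = x0 + x1" by (rule components_decompose)
  obtain y0 y1 where y: "y0 \<in> A 0" "y1 \<in> A 1" "y = y0 + y1" by (rule components_decompose)
  have "grade_aut A ((x0 + y0) + (x1 + y1)) = (x0 + y0) - (x1 + y1)"
    using x y by (intro grade_aut_sum component_add)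
  then show ?thesis using x y by (simp add: grade_aut_sum algebra_simps)
qed

lemma grade_aut_scale: "grade_aut A (scl k x) = scl k (grade_aut A x)"
proof -
  obtain x0 x1 where x: "x0 \<in> A 0" "x1 \<in> A 1" "x = x0 + x1" by (rule components_decompose)
  have "grade_aut A (scl k x0 + scl k x1) = scl k x0 - scl k x1"
    using x by (intro grade_aut_sum component_scale)
  then show ?thesis
    using x by (simp add: grade_aut_sum scale_right_distrib scale_right_diff_distrib)
qed

end

section \<open>Bilinearity of a graded product\<close>

context superalgebra
begin

lemma mult_add_left: "mult (x + y) z = mult x z + mult y z"
  and mult_scale_left: "mult (scl k x) z = scl k (mult x z)"
  using mult_linear_left by (auto simp: Vector_Spaces.linear_iff)

lemma mult_add_right: "mult x (y + z) = mult x y + mult x z"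
  and mult_scale_right: "mult x (scl k z) = scl k (mult x z)"
  using mult_linear_right by (auto simp: Vector_Spaces.linear_iff)

lemma mult_zero: "mult 0 x = 0" "mult x 0 = 0"
  using mult_add_left[of 0 0 x] mult_add_right[of x 0 0] by auto

lemma mult_minus: "mult (- x) y = - mult x y" "mult x (- y) = - mult x y"
  using mult_add_left[of x "- x" y] mult_add_right[of x y "- y"]
  by (auto simp: mult_zero eq_neg_iff_add_eq_0 add.commute)

lemma mult_diff_left: "mult (x - y) z = mult x z - mult y z"
  using mult_add_left[of "x - y" y z] by simp

lemma mult_signed: "mult (signed p x) y = signed p (mult x y)"
    "mult x (signed p y) = signed p (mult x y)"
  by (auto simp: signed_def mult_minus)

lemmas mult_additive = mult_add_left mult_add_right mult_minus mult_signed

end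

section \<open>Commutation and Leibniz rules in a generic Poisson superalgebra\<close>

context gp_superalgebra
begin

text \<open>The sign does not involve the parity of \<open>z\<close>, so additivity removes its
  homogeneity.\<close>

lemma leibniz_right:
  assumes "x \<in> A p" "y \<in> A q"
  shows "br x (mult y z) = mult (br x y) z + signed (p * q) (mult y (br x z))"
proof -
  obtain z0 z1 where "z0 \<in> A 0" "z1 \<in> A 1" "z = z0 + z1" by (rule components_decompose)
  then show ?thesis
    using leibniz[OF assms, of z0 0] leibniz[OF assms, of z1 1]
    by (simp add: mult_add_right bracket.mult_add_right signed_add)
qed

text \<open>Superanticommutativity turns the bracket around, the Leibniz identity applies, and the
  brackets are turned back. The parity of \<open>x\<close> drops out of the sign, so
  \<open>x\<close> may be arbitrary.\<close>

lemma leibniz_left: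
  assumes "y \<in> A q" "z \<in> A r"
  shows "br (mult x y) z = mult x (br y z) + signed (q * r) (mult (br x z) y)"
proof -
  have hom: "br (mult x y) z = mult x (br y z) + signed (q * r) (mult (br x z) y)"
    if "x \<in> A p" for p x
    using bracket_superanticommute[OF mult_graded[OF that assms(1)] assms(2)]
      leibniz[OF assms(2) that assms(1)] bracket_superanticommute[OF assms(2) that]
      bracket_superanticommute[OF assms(2) assms(1)]
    by (cases p; cases q; cases r; simp add: signed_def mult_minus)
  obtain x0 x1 where "x0 \<in> A 0" "x1 \<in> A 1" "x = x0 + x1" by (rule components_decompose)
  then show ?thesis
    using hom[of x0 0] hom[of x1 1]
    by (simp add: mult_add_left bracket.mult_add_left signed_add)
qed

lemma mult_left_supercommute:
  assumes "x \<in> A p" "y \<in> A q"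
  shows "mult x (mult y z) = signed (p * q) (mult y (mult x z))"
  using mult_supercommute[OF assms] by (metis mult_assoc mult_signed(1))

lemma pair_rules:
  assumes "u \<in> A i" "v \<in> A j"
  shows "mult v u = signed (i * j) (mult u v)"
    and "mult v (mult u w) = signed (i * j) (mult u (mult v w))"
    and "br v u = - signed (i * j) (br u v)"
    and "br u (mult v w) = mult (br u v) w + signed (i * j) (mult v (br u w))"
    and "br v (mult u w) = mult (br v u) w + signed (i * j) (mult u (br v w))"
    and "br (mult w u) v = mult w (br u v) + signed (i * j) (mult (br w v) u)"
    and "br (mult w v) u = mult w (br v u) + signed (i * j) (mult (br w u) v)"
  using mult_supercommute[OF assms(2,1)] mult_left_supercommute[OF assms(2,1)]
    bracket_superanticommute[OF assms(2,1)] leibniz_right[OF assms] leibniz_right[OF assms(2,1)]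
    leibniz_left[OF assms] leibniz_left[OF assms(2,1)]
  \<comment> \<open>\<open>mult.commute\<close> concerns the product of parities in
    \<open>bit\<close>: it identifies \<open>j * i\<close> with \<open>i * j\<close>.\<close>
  by (simp_all only: mult.commute)

lemma triple_rules:
  assumes "u \<in> A i" "v \<in> A j" "w \<in> A k"
  shows "mult (br u v) w = signed ((i + j) * k) (mult w (br u v))"
    and "mult (br u v) (mult w z) = signed ((i + j) * k) (mult w (mult (br u v) z))"
    and "br (mult u v) (mult w z) =
      mult (br (mult u v) w) z + signed ((i + j) * k) (mult w (br (mult u v) z))"
  using mult_supercommute[OF bracket.mult_graded[OF assms(1,2)] assms(3)]
    mult_left_supercommute[OF bracket.mult_graded[OF assms(1,2)] assms(3)]
    leibniz_right[OF mult_graded[OF assms(1,2)] assms(3)]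
  by simp_all

section \<open>Kantor's double as a supercommutative superalgebra\<close>

lemma kantor_add:
  "kantor_mult A mult br (x + y) z = kantor_mult A mult br x z + kantor_mult A mult br y z"
  "kantor_mult A mult br x (y + z) = kantor_mult A mult br x y + kantor_mult A mult br x z"
  by (auto simp: kantor_mult_def split_beta prod_eq_iff mult_add_left mult_add_right
      bracket.mult_add_left bracket.mult_add_right grade_aut_add)

lemma grade_aut_graded: "x \<in> A p \<Longrightarrow> grade_aut A x \<in> A p"
  by (simp add: grade_aut_homogeneous component_signed)

lemma kantor_superalgebra:
  "superalgebra (module_prod.scale scl scl) (kantor_grading A) (kantor_mult A mult br)"
proof -
  interpret P: vector_space_prod scl scl ..
  have scale:
    "kantor_mult A mult br x (P.scale k y) = P.scale k (kantor_mult A mult br x y)"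
    "kantor_mult A mult br (P.scale k x) y = P.scale k (kantor_mult A mult br x y)" for k x y
    by (simp_all add: kantor_mult_def P.scale_def split_beta mult_scale_left mult_scale_right
        bracket.mult_scale_left bracket.mult_scale_right grade_aut_scale scale_right_distrib)
  show ?thesis
  proof
    show "P.p.subspace (kantor_grading A p)" for p
      unfolding kantor_grading_def by (intro P.subspace_Times subspace_component)
    show "kantor_grading A 0 \<inter> kantor_grading A 1 = {0}"
      using components_disjoint by (auto simp: kantor_grading_def zero_prod_def)
    show "\<exists>y\<in>kantor_grading A 0. \<exists>z\<in>kantor_grading A 1. x = y + z" for x
    proof -
      obtain a0 a1 where a: "a0 \<in> A 0" "a1 \<in> A 1" "fst x = a0 + a1" by (rule components_decompose)
      obtain b0 b1 where b: "b0 \<in> A 0" "b1 \<in> A 1" "snd x = b0 + b1" by (rule components_decompose)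
      \<comment> \<open>The adjoined \<open>x\<close> is odd, so the odd \<open>b1\<close>
        contributes to the even component and \<open>b0\<close> to the odd one.\<close>
      have "(a0, b1) \<in> kantor_grading A 0" "(a1, b0) \<in> kantor_grading A 1"
        using a b by (auto simp: kantor_grading_def)
      moreover have "x = (a0, b1) + (a1, b0)"
        using a b by (simp add: prod_eq_iff add.commute)
      ultimately show ?thesis by blast
    qed
    show "kantor_mult A mult br x y \<in> kantor_grading A (p + q)"
      if "x \<in> kantor_grading A p" "y \<in> kantor_grading A q" for x y p q
    proof -
      obtain a b c d where xy: "x = (a, b)" "y = (c, d)" by (cases x, cases y)
      with that have h: "a \<in> A p" "b \<in> A (p + 1)" "c \<in> A q" "d \<in> A (q + 1)"
        by (auto simp: kantor_grading_def)
      note mult_graded[OF h(1,3)] bracket.mult_graded[OF h(2) grade_aut_graded[OF h(4)]]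
        mult_graded[OF h(1,4)] mult_graded[OF h(2) grade_aut_graded[OF h(3)]]
      moreover have "(p + 1) + (q + 1) = p + q" "p + (q + 1) = p + q + 1"
        "(p + 1) + q = p + q + 1"
        by (cases p; cases q; simp)+
      ultimately show ?thesis
        by (auto simp: xy kantor_mult_def kantor_grading_def intro: component_add)
    qed
  qed (simp_all add: kantor_add scale)
qed

text \<open>For two factors in \<open>Ax\<close> the bracket contributes the sign exponent
  \<open>(p + 1) * (q + 1) = p * q + p + q + 1\<close>. The signs in the definition of the product
  absorb \<open>p + q\<close>, and the minus sign of superanticommutativity absorbs the
  \<open>1\<close>.\<close>

lemma kantor_supercommute:
  assumes "x \<in> kantor_grading A p" "y \<in> kantor_grading A q"
  shows "kantor_mult A mult br x y = signed (p * q) (kantor_mult A mult br y x)"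
proof -
  obtain a b c d where xy: "x = (a, b)" "y = (c, d)" by (cases x, cases y)
  with assms have h: "a \<in> A p" "b \<in> A (p + 1)" "c \<in> A q" "d \<in> A (q + 1)"
    by (auto simp: kantor_grading_def)
  note c = mult_supercommute[OF h(1,3)] mult_supercommute[OF h(1,4)]
    mult_supercommute[OF h(2,3)] bracket_superanticommute[OF h(2,4)]
  show ?thesis
    unfolding xy kantor_mult_def prod.case h[THEN grade_aut_homogeneous]
    by (simp only: c signed_Pair mult_signed bracket.mult_signed,
        cases p; cases q; simp add: signed_def add.commute)
qed

text \<open>The element \<open>a\<close> times \<open>x\<close> to the power \<open>f\<close>. With
  a \<open>bit\<close> as exponent, the parity of the image is \<open>p + f\<close>, and one
  statement covers all placements of arguments in \<open>A\<close> or \<open>Ax\<close>.\<close>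

definition kantor_embed :: "bit \<Rightarrow> 'a \<Rightarrow> 'a \<times> 'a" where
  "kantor_embed f a = (if f = 0 then (a, 0) else (0, a))"

lemma kantor_mult_embed:
  assumes "b \<in> A q"
  shows "kantor_mult A mult br (kantor_embed 0 a) (kantor_embed 0 b) = kantor_embed 0 (mult a b)"
    and "kantor_mult A mult br (kantor_embed 0 a) (kantor_embed 1 b) = kantor_embed 1 (mult a b)"
    and "kantor_mult A mult br (kantor_embed 1 a) (kantor_embed 0 b)
      = kantor_embed 1 (signed q (mult a b))"
    and "kantor_mult A mult br (kantor_embed 1 a) (kantor_embed 1 b)
      = kantor_embed 0 (signed q (br a b))"
  using kantor_mult_homogeneous[OF assms] by (simp_all add: kantor_embed_def)

lemma kantor_embed_add: "kantor_embed f x + kantor_embed f y = kantor_embed f (x + y)"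
  and signed_kantor_embed: "signed q (kantor_embed f x) = kantor_embed f (signed q x)"
  and kantor_embed_diff: "kantor_embed f x - kantor_embed f y = kantor_embed f (x - y)"
  by (simp_all add: kantor_embed_def signed_def)

lemma kantor_embed_eq: "kantor_embed f x = kantor_embed f y \<longleftrightarrow> x = y"
  by (simp add: kantor_embed_def)

section \<open>The Jordan identity on elements of \<open>A\<close> and \<open>Ax\<close>\<close>

definition jordan_defect ::
  "bit \<Rightarrow> bit \<Rightarrow> bit \<Rightarrow> bit
    \<Rightarrow> 'a \<times> 'a \<Rightarrow> 'a \<times> 'a \<Rightarrow> 'a \<times> 'a \<Rightarrow> 'a \<times> 'a \<Rightarrow> 'a \<times> 'a" where
  "jordan_defect p q r s x y z t = (let K = kantor_mult A mult br in
     K (K x y) (K z t) + signed (q * r) (K (K x z) (K y t))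
     + signed (s * (q + r)) (K (K x t) (K y z))
     - (K (K (K x y) z) t + signed (s * (q + r) + q * r) (K (K (K x t) z) y)
     + signed (p * (q + r + s) + r * s) (K (K (K y t) z) x)))"

text \<open>Every monomial contains each argument exactly once, and the signs depend only on the
  fixed parities.\<close>

lemma jordan_defect_add:
  fixes p q r s :: bit
  defines "D \<equiv> jordan_defect p q r s"
  shows "D (x + x') y z t = D x y z t + D x' y z t"
    and "D x (y + y') z t = D x y z t + D x y' z t"
    and "D x y (z + z') t = D x y z t + D x y z' t"
    and "D x y z (t + t') = D x y z t + D x y z t'"
  unfolding D_def jordan_defect_def Let_def
  by (simp_all only: kantor_add signed_add) (simp_all add: algebra_simps)

text \<open>
  The rewrite rules bring every term into a form in which brackets contain no products, the factors
  \<open>a, b, c, d\<close> are in alphabetical order and the bracket stands last; they are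
  instantiated by hand because supercommutativity as a general rule would loop.
\<close>

lemma jordan_defect_embed:
  assumes a: "a \<in> A p" and b: "b \<in> A q" and c: "c \<in> A r" and d: "d \<in> A s"
    and "f = 0 \<or> g = 0 \<or> h = 0 \<or> k = 0"
  shows "jordan_defect (p + f) (q + g) (r + h) (s + k)
    (kantor_embed f a) (kantor_embed g b) (kantor_embed h c) (kantor_embed k d) = 0"
proof -
  note two = pair_rules[OF a b] pair_rules[OF a c] pair_rules[OF a d]
    pair_rules[OF b c] pair_rules[OF b d] pair_rules[OF c d]
  note three = triple_rules[OF a b c] triple_rules[OF a b d] triple_rules[OF a c b]
    triple_rules[OF a c d] triple_rules[OF a d b] triple_rules[OF a d c]
    triple_rules[OF b c a] triple_rules[OF b c d] triple_rules[OF b d a]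
    triple_rules[OF b d c] triple_rules[OF c d a] triple_rules[OF c d b]
  note norm = two three leibniz_left[OF mult_graded[OF b c] d]
    leibniz_left[OF mult_graded[OF c d] a] leibniz_left[OF mult_graded[OF c d] b]
    mult_assoc mult_additive bracket.mult_additive
    signed_add signed_minus signed_signed
  \<comment> \<open>Evaluating a product in the double requires the parity of its right factor,
    which may itself be a product or a bracket, with or without a sign.\<close>
  note pairs = mult_graded[OF a b] mult_graded[OF c d] mult_graded[OF a c] mult_graded[OF b d]
    mult_graded[OF a d] mult_graded[OF b c]
    bracket.mult_graded[OF a b] bracket.mult_graded[OF c d] bracket.mult_graded[OF a c]
    bracket.mult_graded[OF b d] bracket.mult_graded[OF a d] bracket.mult_graded[OF b c]
  note prods = kantor_mult_embed[OF a] kantor_mult_embed[OF b] kantor_mult_embed[OF c]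
    kantor_mult_embed[OF d] pairs[THEN component_signed, THEN kantor_mult_embed(1)]
    pairs[THEN component_signed, THEN kantor_mult_embed(2)]
    pairs[THEN component_signed, THEN kantor_mult_embed(3)]
    pairs[THEN component_signed, THEN kantor_mult_embed(4)]
    pairs[THEN kantor_mult_embed(1)] pairs[THEN kantor_mult_embed(2)]
    pairs[THEN kantor_mult_embed(3)] pairs[THEN kantor_mult_embed(4)]
  show ?thesis
    using assms(5) unfolding jordan_defect_def Let_def right_minus_eq
    \<comment> \<open>Fifteen placements satisfy the hypothesis; each gives an identity in
      \<open>A\<close>, checked for all sixteen choices of parities.\<close>
    by (cases f; cases g; cases h; cases k;
        simp only: prods signed_kantor_embed kantor_embed_add kantor_embed_eq norm;
        cases p; cases q; cases r; cases s; simp add: signed_def algebra_simps)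
qed

text \<open>Each monomial on the right of the Jordan identity multiplies by its third argument
  second. Hence \<open>c\<close> always stands as a plain factor inside the outer bracket, and
  \<open>leibniz_left\<close> splits it off, leaving a Jacobian in \<open>a, b, d\<close>.\<close>

lemma jordan_defect_embed_one:
  assumes a: "a \<in> A p" and b: "b \<in> A q" and c: "c \<in> A r" and d: "d \<in> A s"
  shows "jordan_defect (p + 1) (q + 1) (r + 1) (s + 1)
      (kantor_embed 1 a) (kantor_embed 1 b) (kantor_embed 1 c) (kantor_embed 1 d)
    = kantor_embed 0 (- signed (q + s + r * s)
        (mult (br (br a b) d - signed (q * s) (br (br a d) b) - br a (br b d)) c))"
proof -
  note prods = kantor_mult_embed[OF a] kantor_mult_embed[OF b] kantor_mult_embed[OF c]
    kantor_mult_embed[OF d]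
    kantor_mult_embed(1)[OF component_signed[OF bracket.mult_graded[OF c d]]]
    kantor_mult_embed(1)[OF component_signed[OF bracket.mult_graded[OF b d]]]
    kantor_mult_embed(1)[OF component_signed[OF bracket.mult_graded[OF b c]]]
  \<comment> \<open>These align the products of two brackets on both sides, and turn the bracket of
    \<open>br b d\<close> with \<open>a\<close> into the last term of the Jacobian.\<close>
  note comm = bracket_superanticommute[OF c b] bracket_superanticommute[OF c a]
    bracket_superanticommute[OF bracket.mult_graded[OF b d] a]
    mult_supercommute[OF bracket.mult_graded[OF b d] bracket.mult_graded[OF a c]]
  show ?thesis
    unfolding jordan_defect_def Let_def
    by (simp only: prods signed_kantor_embed kantor_embed_add kantor_embed_diff kantor_embed_eq
        leibniz_left[OF c d] leibniz_left[OF c b] leibniz_left[OF c a] comm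
        mult_additive mult_diff_left signed_diff bracket.mult_additive signed_add
        signed_minus signed_signed;
        cases p; cases q; cases r; cases s; simp add: signed_def algebra_simps)
qed

lemma kantor_embed_graded: "a \<in> A p \<Longrightarrow> kantor_embed f a \<in> kantor_grading A (p + f)"
  by (cases f; cases p; simp add: kantor_embed_def kantor_grading_def component_zero)

text \<open>A pair is the sum of its two embedded coordinates, the second of parity
  \<open>p + 1\<close>, and \<open>p + 1 + 1 = p\<close> in \<open>bit\<close>. The form of an
  induction rule lets additivity be used one argument at a time.\<close>

lemma kantor_grading_induct [consumes 1, case_names embed add]:
  assumes "x \<in> kantor_grading A p"
    and "\<And>f a q. a \<in> A q \<Longrightarrow> p = q + f \<Longrightarrow> P (kantor_embed f a)"
    and "\<And>y z. P y \<Longrightarrow> P z \<Longrightarrow> P (y + z)"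
  shows "P x"
proof -
  have "fst x \<in> A p" "snd x \<in> A (p + 1)" using assms(1) by (auto simp: kantor_grading_def)
  then have "P (kantor_embed 0 (fst x))" "P (kantor_embed 1 (snd x))"
    using assms(2)[of "fst x" p 0] assms(2)[of "snd x" "p + 1" 1] by (auto simp: add.assoc)
  then have "P (kantor_embed 0 (fst x) + kantor_embed 1 (snd x))" by (rule assms(3))
  then show ?thesis by (simp add: kantor_embed_def)
qed

lemma jordan_defect_eq_0:
  assumes jacobi: "\<forall>p q r s. \<forall>a\<in>A p. \<forall>b\<in>A q. \<forall>c\<in>A r. \<forall>d\<in>A s.
      mult (br (br a b) c - signed (q * r) (br (br a c) b) - br a (br b c)) d = 0"
    and x: "x \<in> kantor_grading A p" and y: "y \<in> kantor_grading A q"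
    and z: "z \<in> kantor_grading A r" and t: "t \<in> kantor_grading A s"
  shows "jordan_defect p q r s x y z t = 0"
  using x
proof (induction rule: kantor_grading_induct)
  case x: (embed f a p')
  show ?case using y
  proof (induction rule: kantor_grading_induct)
    case y: (embed g b q')
    show ?case using z
    proof (induction rule: kantor_grading_induct)
      case z: (embed h c r')
      show ?case using t
      proof (induction rule: kantor_grading_induct)
        case t: (embed k d s')
        show ?case
        proof (cases "f = 0 \<or> g = 0 \<or> h = 0 \<or> k = 0")
          case True
          then show ?thesis using jordan_defect_embed x y z t by blast
        next
          case False
          then have "f = 1" "g = 1" "h = 1" "k = 1" by auto
          \<comment> \<open>The hypothesis is applied with its last two arguments exchanged, since
            here \<open>c\<close> is the outer factor.\<close>
          moreover have "mult (br (br a b) d - signed (q' * s') (br (br a d) b) - br a (br b d)) c = 0"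
            using jacobi x y z t by blast
          ultimately show ?thesis
            using jordan_defect_embed_one[OF x(1) y(1) z(1) t(1)] x y z t
            by (simp only: signed_zero) (simp add: kantor_embed_def zero_prod_def)
        qed
      qed (simp add: jordan_defect_add)
    qed (simp add: jordan_defect_add)
  qed (simp add: jordan_defect_add)
qed (simp add: jordan_defect_add)

section \<open>Equivalence of the Jordan identity with the Jacobian condition\<close>

lemma kantor_jordan_iff:
  "jordan_superalgebra (module_prod.scale scl scl) (kantor_grading A) (kantor_mult A mult br)
    \<longleftrightarrow> (\<forall>p q r s. \<forall>a\<in>A p. \<forall>b\<in>A q. \<forall>c\<in>A r. \<forall>d\<in>A s.
          mult (br (br a b) c - signed (q * r) (br (br a c) b) - br a (br b c)) d = 0)"
    (is "?J \<longleftrightarrow> ?I")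
proof
  assume ?J
  then interpret K: jordan_superalgebra
    "module_prod.scale scl scl" "kantor_grading A" "kantor_mult A mult br" .
  show ?I
  proof (intro allI ballI)
    fix p q r s a b c d
    assume h: "a \<in> A p" "b \<in> A q" "c \<in> A r" "d \<in> A s"
    \<comment> \<open>Putting \<open>d\<close> in the third place makes it the outer factor, so the
      Jacobian appears in \<open>a, b, c\<close>.\<close>
    have "jordan_defect (p + 1) (q + 1) (s + 1) (r + 1)
      (kantor_embed 1 a) (kantor_embed 1 b) (kantor_embed 1 d) (kantor_embed 1 c) = 0"
      unfolding jordan_defect_def Let_def right_minus_eq
      by (intro K.jordan_identity kantor_embed_graded h)
    then have "kantor_embed 0 (- signed (q + r + s * r)
        (mult (br (br a b) c - signed (q * r) (br (br a c) b) - br a (br b c)) d)) = 0"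
      by (simp only: jordan_defect_embed_one[OF h(1,2,4,3)])
    then show "mult (br (br a b) c - signed (q * r) (br (br a c) b) - br a (br b c)) d = 0"
      by (simp add: kantor_embed_def zero_prod_def signed_cancel)
  qed
next
  assume I: ?I
  interpret K: superalgebra
    "module_prod.scale scl scl" "kantor_grading A" "kantor_mult A mult br"
    by (rule kantor_superalgebra)
  show ?J
    by unfold_locales (fact kantor_supercommute,
      fact jordan_defect_eq_0[OF I, unfolded jordan_defect_def Let_def right_minus_eq])
qed

end

theorem theorem16:
  fixes scl :: "'f::field \<Rightarrow> 'a::ab_group_add \<Rightarrow> 'a"
    and A :: "bit \<Rightarrow> 'a set"
    and mult br :: "'a \<Rightarrow> 'a \<Rightarrow> 'a"
  assumes "CHAR('f) \<noteq> 2" and "CHAR('f) \<noteq> 3"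
    and "gp_superalgebra scl A mult br"
  shows "jordan_superalgebra (module_prod.scale scl scl) (kantor_grading A) (kantor_mult A mult br)
    \<longleftrightarrow> (\<forall>p q r s. \<forall>a\<in>A p. \<forall>b\<in>A q. \<forall>c\<in>A r. \<forall>d\<in>A s.
          mult (br (br a b) c - signed (q * r) (br (br a c) b) - br a (br b c)) d = 0)"
  by (rule gp_superalgebra.kantor_jordan_iff[OF assms(3)])

end
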